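(* Let $n\geqslant 2$, $p>1$, let $D\subset\mathbb{R}^n$ be a domain, let $f:D\to\mathbb{R}^n$ be a mapping and let $y_0\in\overline{f(D)}\setminus\{\infty\}$. Then, for every $y\neq y_0$ such that $f$ is differentiable with $J(x,f)\neq0$ at every $x\in f^{-1}(y)$, $$K_{CT,p,y_0}(y,f)\leqslant K_{I,p}(y,f^{-1}).$$
   Context: Here $(\cdot,\cdot)$ is the Euclidean scalar product, $f'(x)$ is the derivative of $f$ at $x$, $J(x,f)=\det f'(x)$, and $\Vert f'(x)\Vert=\max_{h\in\mathbb{R}^n\setminus\{0\}}\frac{|f'(x)h|}{|h|}$. The cotangent dilatation of $f$ of order $p$ at $y_0$ is $$K_{CT,p,y_0}(y,f)=\sum_{x\in f^{-1}(y)}\frac{\left(\sup_{|h|=1}\left|\left(f'(x)h,\frac{f(x)-y_0}{|f(x)-y_0|}\right)\right|\right)^p}{|J(x,f)|},$$ and $$K_{I,p}(y,f^{-1}):=\sum_{x\in f^{-1}(y)}\frac{\Vert f'(x)\Vert^p}{|J(x,f)|}$$ (in this notation $f$ need not be injective; both sums take values in $[0,\infty]$). The closure $\overline{f(D)}$ is taken in $\overline{\mathbb{R}^n}=\mathbb{R}^n\cup\{\infty\}$. *)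

theory Defs
  imports "HOL-Analysis.Analysis"
begin

definition jac_det :: "(real^'n \<Rightarrow> real^'n) \<Rightarrow> real^'n \<Rightarrow> real"
  where "jac_det f x = det (jacobian f (at x))"

text \<open>
  A mapping on \<open>D\<close> is a total function of which only the values on \<open>D\<close> matter, so the
  preimage of a point is taken inside \<open>D\<close>. The derivative \<open>frechet_derivative f (at x)\<close>,
  and the real supremum and operator norm built from it, are meaningful only at points
  \<open>x\<close> of an open \<open>D\<close> where \<open>f\<close> is differentiable; the dilatations are to be used at
  values \<open>y\<close> for which this holds on the whole preimage.
  The sums are unordered sums in \<open>[0, \<infinity>]\<close> over a possibly infinite preimage; in
  \<open>ennreal\<close> such a sum always exists, and it is \<open>0\<close> over the empty preimage.
\<close>

definition K_CT ::
    "real \<Rightarrow> real^'n \<Rightarrow> (real^'n) set \<Rightarrow> (real^'n \<Rightarrow> real^'n) \<Rightarrow> real^'n \<Rightarrow> ennreal"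
  where "K_CT p y0 D f y =
    (\<Sum>\<^sub>\<infinity>x\<in>D \<inter> f -` {y}.
      ennreal ((SUP h\<in>{h. norm h = 1}.
          \<bar>frechet_derivative f (at x) h \<bullet> ((f x - y0) /\<^sub>R norm (f x - y0))\<bar>) powr p)
        / ennreal \<bar>jac_det f x\<bar>)"

text \<open>
  The supremum in \<open>onorm\<close> also ranges over \<open>h = 0\<close>, which contributes the quotient
  \<open>0 / 0 = 0\<close> and so does not change the maximum over \<open>h \<noteq> 0\<close>.
\<close>

definition K_I ::
    "real \<Rightarrow> (real^'n) set \<Rightarrow> (real^'n \<Rightarrow> real^'n) \<Rightarrow> real^'n \<Rightarrow> ennreal"
  where "K_I p D f y =
    (\<Sum>\<^sub>\<infinity>x\<in>D \<inter> f -` {y}.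
      ennreal (onorm (frechet_derivative f (at x)) powr p) / ennreal \<bar>jac_det f x\<bar>)"

text \<open>
  The extended space is the one-point compactification, with \<open>None\<close> as the point at
  infinity; finite points \<open>y\<close> appear in it as \<open>Some y\<close>.
\<close>

definition ext_closure :: "(real^'n) set \<Rightarrow> (real^'n) option set"
  where "ext_closure S = Alexandroff_compactification euclidean closure_of (Some ` S)"

end

theory Submission
  imports Defs
begin

text \<open>Both dilatations sum over the same preimage with the same denominators, so it suffices
  to compare numerators at each point. There Cauchy-Schwarz bounds the component of
  \<open>A h\<close> along a vector of norm at most 1 by \<open>norm (A h)\<close>, hence by
  \<open>onorm A\<close> for unit \<open>h\<close>; this is \<open>SUP_abs_inner_le_onorm\<close>,
  with \<open>A\<close> the derivative.\<close>

lemma SUP_abs_inner_le_onorm: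
  fixes A :: "'a::euclidean_space \<Rightarrow> 'b::real_inner"
  assumes A: "bounded_linear A" and u: "norm u \<le> 1"
  shows "0 \<le> (SUP h\<in>{h. norm h = 1}. \<bar>A h \<bullet> u\<bar>)"
    and "(SUP h\<in>{h. norm h = 1}. \<bar>A h \<bullet> u\<bar>) \<le> onorm A"
proof -
  have bound: "\<bar>A h \<bullet> u\<bar> \<le> onorm A" if "norm h = 1" for h
  proof -
    have "\<bar>A h \<bullet> u\<bar> \<le> norm (A h) * norm u"
      by (rule Cauchy_Schwarz_ineq2)
    also have "\<dots> \<le> norm (A h) * 1"
      using u by (intro mult_left_mono) auto
    also have "\<dots> \<le> onorm A"
      using onorm[OF A, of h] that by simp
    finally show ?thesis .
  qed
  \<comment> \<open>A real supremum is meaningful only over a nonempty set that is bounded above;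
    \<open>e\<close> gives nonemptiness and the term that shows the supremum is nonnegative.\<close>
  obtain e :: 'a where e: "norm e = 1"
    using vector_choose_size[of 1] by auto
  show "(SUP h\<in>{h. norm h = 1}. \<bar>A h \<bullet> u\<bar>) \<le> onorm A"
    using e bound by (intro cSUP_least) auto
  have "bdd_above ((\<lambda>h. \<bar>A h \<bullet> u\<bar>) ` {h. norm h = 1})"
    using bound by (auto intro!: bdd_aboveI)
  then show "0 \<le> (SUP h\<in>{h. norm h = 1}. \<bar>A h \<bullet> u\<bar>)"
    using e by (intro cSUP_upper2[of _ _ e]) auto
qed

theorem mainTheorem2:
  fixes D :: "(real^'n) set" and f :: "real^'n \<Rightarrow> real^'n"
    and p :: real and y0 :: "real^'n"
  assumes "CARD('n) \<ge> 2" and "p > 1"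
    and "open D" and "connected D" and "D \<noteq> {}"
    and "Some y0 \<in> ext_closure (f ` D)"
  shows "\<forall>y. y \<noteq> y0 \<longrightarrow>
      (\<forall>x\<in>D \<inter> f -` {y}. f differentiable (at x) \<and> jac_det f x \<noteq> 0) \<longrightarrow>
      K_CT p y0 D f y \<le> K_I p D f y"
proof (intro allI impI)
  fix y
  assume diff: "\<forall>x\<in>D \<inter> f -` {y}. f differentiable (at x) \<and> jac_det f x \<noteq> 0"
  show "K_CT p y0 D f y \<le> K_I p D f y"
    unfolding K_CT_def K_I_def
  \<comment> \<open>In \<open>ennreal\<close> every family is summable, so the termwise inequality
    is all that remains, even for an infinite preimage.\<close>
  proof (intro infsum_mono nonneg_summable_on_complete divide_right_mono_ennreal ennreal_leI)
    fix x assume "x \<in> D \<inter> f -` {y}"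
    with diff have A: "bounded_linear (frechet_derivative f (at x))"
      using frechet_derivative_works has_derivative_bounded_linear by blast
    \<comment> \<open>The norm is 1, or 0 if \<open>f x = y0\<close>, since
      \<open>inverse 0 = 0\<close>.\<close>
    have u: "norm ((f x - y0) /\<^sub>R norm (f x - y0)) \<le> 1"
      by (cases "f x = y0") auto
    show "(SUP h\<in>{h. norm h = 1}.
          \<bar>frechet_derivative f (at x) h \<bullet> ((f x - y0) /\<^sub>R norm (f x - y0))\<bar>) powr p
        \<le> onorm (frechet_derivative f (at x)) powr p"
      \<comment> \<open>Monotonicity of \<open>powr\<close> in its base requires the smaller base to
        be nonnegative, which is the first claim of the lemma.\<close>
      using \<open>p > 1\<close> SUP_abs_inner_le_onorm[OF A u] by (intro powr_mono2) auto
  qed auto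
qed

end
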